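(* For every finite field $\mathbb{F}$, a finite simple graph $G$ is $2$-subspace choosable over $\mathbb{F}$ if and only if $G$ contains no cycles.
   Context: For a finite field $\mathbb{F}$, the inner product on $\mathbb{F}^t$ is $\langle x,y\rangle=\sum_i x_iy_i$. A finite simple graph $G=(V,E)$ is $k$-subspace choosable over $\mathbb{F}$ if for every integer $t$ and every assignment of subspaces $W_v\subseteq\mathbb{F}^t$ with $\dim(W_v)=k$ to the vertices $v\in V$, there exists a choice of a nonzero vector $x_v\in W_v$ for each $v\in V$ such that $\langle x_v,x_{v'}\rangle=0$ whenever $v$ and $v'$ are adjacent in $G$. *)

theory Defs
  imports "Jordan_Normal_Form.VS_Connect" "Graph_Theory.Graph_Theory"
begin

text \<open>
  A finite simple graph is a \<^locale>\<open>pair_graph\<close>: finite vertex set, and an arc set that is a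
  finite, symmetric, irreflexive relation on it, each undirected edge being the two arcs between
  its ends. In this encoding going along an edge and back is already a \<^const>\<open>pre_digraph.cycle\<close>
  (of length 2), and a \<^const>\<open>forest\<close> has no edges at all, so cycles of the undirected graph
  are the directed ones of length at least 3.
\<close>

definition undirected_cycle :: "'v pair_pre_digraph \<Rightarrow> ('v \<times> 'v) list \<Rightarrow> bool" where
  "undirected_cycle G p \<longleftrightarrow> pre_digraph.cycle (with_proj G) p \<and> length p \<ge> 3"

definition subspace_choosable ::
  "'f::{field, finite} itself \<Rightarrow> nat \<Rightarrow> 'v pair_pre_digraph \<Rightarrow> bool" where
  "subspace_choosable (F :: 'f itself) k G \<longleftrightarrow>
     (\<forall>(t :: nat) (W :: 'v \<Rightarrow> 'f vec set).
        (\<forall>v \<in> pverts G.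
           VectorSpace.subspace class_ring (W v) (module_vec F t) \<and>
           vectorspace.dim class_ring ((module_vec F t)\<lparr>carrier := W v\<rparr>) = k) \<longrightarrow>
        (\<exists>x :: 'v \<Rightarrow> 'f vec.
           (\<forall>v \<in> pverts G. x v \<in> W v \<and> x v \<noteq> 0\<^sub>v t) \<and>
           (\<forall>(v, v') \<in> parcs G. x v \<bullet> x v' = 0)))"

end

theory Submission
  imports Defs "HOL-Library.Cardinality"
begin

text \<open>
  If the graph is acyclic, the vectors are chosen greedily. Every nonempty set of vertices contains
  one with at most one neighbour inside the set (an end of a longest path), so after a vector is
  chosen for each of the other vertices there is at most one vector \<open>u\<close> to which the vector of this
  last vertex must be orthogonal; a plane contains a nonzero vector orthogonal to any given one
  (\<open>exists_nonzero_orthogonal\<close>, \<open>acyclic_imp_orthogonal_choice\<close>).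

  If there is a cycle \<open>v\<^sub>0, \<dots>, v\<^sub>m\<close>, take \<open>t = 4\<close> and let every space be the graph of a linear map
  from the plane of the first two coordinates to that of the last two. With the zero map at the
  inner vertices \<open>v\<^sub>1, \<dots>, v\<^sub>m\<^sub>-\<^sub>1\<close>, two vectors at consecutive vertices of the path are orthogonal iff
  their first two coordinates are. As orthogonality in a plane determines a vector up to a scalar,
  walking along the path turns the plane by a quarter turn at each step: the coordinates at \<open>v\<^sub>m\<close>
  are, up to a nonzero scalar, those at \<open>v\<^sub>0\<close> if \<open>m\<close> is even, and those at \<open>v\<^sub>0\<close> turned by a
  right angle if \<open>m\<close> is odd (\<open>orthogonal_chain\<close>). The maps at the two ends are then chosen so that
  the condition on the closing edge says that the first two coordinates \<open>(a, b)\<close> at \<open>v\<^sub>0\<close> are a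
  zero of a quadratic form. Over a finite field there are binary forms without nontrivial zeros
  (\<open>exists_anisotropic_form\<close>), so with such a form no choice of nonzero vectors exists
  (\<open>vertex_cycle_imp_no_orthogonal_choice\<close>).

  Both halves speak about dimension through counting alone: over a field with \<open>q\<close> elements a
  subspace has dimension \<open>2\<close> iff it has \<open>q\<^sup>2\<close> elements (\<open>card_subspace\<close>).
\<close>

section \<open>Dimension by counting\<close>

text \<open>
  A basis \<open>B\<close> turns the vectors of \<open>W\<close> into the coefficient functions on \<open>B\<close>. A dimension can thus be
  computed by exhibiting a bijection, with no basis in sight, and used by the pigeonhole principle.
\<close>

lemma card_subspace:
  fixes W :: "'f::{field, finite} vec set"
  assumes "VectorSpace.subspace class_ring W (module_vec TYPE('f) t)"
  shows "card W = CARD('f) ^ vectorspace.dim class_ring ((module_vec TYPE('f) t)\<lparr>carrier := W\<rparr>)"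
proof -
  let ?U = "(module_vec TYPE('f) t)\<lparr>carrier := W\<rparr>"
  interpret V: vectorspace class_ring "module_vec TYPE('f) t"
    by (rule vec_vs)
  interpret U: vectorspace class_ring ?U
    by (rule V.subspace_is_vs[OF assms])
  have "W \<subseteq> carrier_vec t"
    using assms by (auto simp: VectorSpace.subspace_def submodule_def module_vec_simps)
  moreover have "carrier_vec t \<subseteq> vec_of_list ` {xs :: 'f list. set xs \<subseteq> UNIV \<and> length xs = t}"
  proof
    fix v :: "'f vec" assume "v \<in> carrier_vec t"
    then show "v \<in> vec_of_list ` {xs. set xs \<subseteq> UNIV \<and> length xs = t}"
      by (intro image_eqI[of _ _ "list_of_vec v"]) (auto simp: vec_list)
  qed
  ultimately have "finite W"
    using finite_lists_length_eq[of "UNIV :: 'f set" t] by (meson finite_imageI finite_subset finite)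
  then have "U.fin_dim"
    unfolding U.fin_dim_def using U.span_is_subset2[of W] U.in_own_span[of W]
    by (intro exI[of _ W]) auto
  then obtain B where B: "finite B" "U.basis B"
    using U.finite_basis_exists by blast
  then have BW: "B \<subseteq> W"
    by (auto simp: U.basis_def)
  have uniq: "\<exists>!a. a \<in> B \<rightarrow>\<^sub>E UNIV \<and> U.lincomb a B = v" if "v \<in> W" for v
    using U.basis_criterion[of B] B BW that by simp
  have "bij_betw (\<lambda>a. U.lincomb a B) (B \<rightarrow>\<^sub>E UNIV) W"
  proof (rule bij_betw_imageI)
    have closed: "U.lincomb a B \<in> W" for a
      using U.lincomb_closed[of B a] BW by simp
    show "inj_on (\<lambda>a. U.lincomb a B) (B \<rightarrow>\<^sub>E UNIV)"
      using uniq closed by (metis (no_types, lifting) inj_onI)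
    show "(\<lambda>a. U.lincomb a B) ` (B \<rightarrow>\<^sub>E UNIV) = W"
      using uniq closed by blast
  qed
  then have "card W = card (B \<rightarrow>\<^sub>E (UNIV :: 'f set))"
    by (simp add: bij_betw_same_card)
  also have "\<dots> = CARD('f) ^ card B"
    using B(1) by (simp add: card_PiE)
  finally show ?thesis
    using U.dim_basis[OF B] by simp
qed

lemma card_field_gt_1: "1 < CARD('f::{field, finite})"
proof -
  have "card {0, 1 :: 'f} \<le> CARD('f)"
    by (intro card_mono) auto
  then show ?thesis by simp
qed

lemma subspace_dim_iff_card:
  fixes W :: "'f::{field, finite} vec set"
  assumes "VectorSpace.subspace class_ring W (module_vec TYPE('f) t)"
  shows "vectorspace.dim class_ring ((module_vec TYPE('f) t)\<lparr>carrier := W\<rparr>) = k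
    \<longleftrightarrow> card W = CARD('f) ^ k"
  using card_subspace[OF assms] card_field_gt_1[where 'f='f] by simp

lemma vec_subspace_iff:
  fixes W :: "'f::{field, finite} vec set"
  shows "VectorSpace.subspace class_ring W (module_vec TYPE('f) t) \<longleftrightarrow>
    W \<subseteq> carrier_vec t \<and> 0\<^sub>v t \<in> W \<and> (\<forall>v\<in>W. \<forall>w\<in>W. v + w \<in> W) \<and> (\<forall>c. \<forall>v\<in>W. c \<cdot>\<^sub>v v \<in> W)"
  using vec_vs[where 'a='f and n=t] vec_module[where 'a='f and n=t]
  by (auto simp: VectorSpace.subspace_def submodule_def module_vec_simps)

text \<open>
  The scalar product with \<open>u\<close> maps \<open>W\<close> to a smaller set, so it identifies two distinct vectors,
  and their difference is orthogonal to \<open>u\<close>.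
\<close>

lemma exists_nonzero_orthogonal:
  fixes W :: "'f::{field, finite} vec set"
  assumes W: "VectorSpace.subspace class_ring W (module_vec TYPE('f) t)"
    and card: "CARD('f) < card W" and u: "u \<in> carrier_vec t"
  shows "\<exists>y\<in>W. y \<noteq> 0\<^sub>v t \<and> y \<bullet> u = 0"
proof -
  have "\<not> inj_on (\<lambda>y. y \<bullet> u) W"
  proof
    assume "inj_on (\<lambda>y. y \<bullet> u) W"
    then have "card W \<le> CARD('f)"
      by (rule card_inj_on_le) auto
    with card show False by simp
  qed
  then obtain y z where yz: "y \<in> W" "z \<in> W" "y \<noteq> z" "y \<bullet> u = z \<bullet> u"
    by (auto simp: inj_on_def)
  have dims: "y \<in> carrier_vec t" "z \<in> carrier_vec t"
    using W yz by (auto simp: vec_subspace_iff)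
  have "y + (-1) \<cdot>\<^sub>v z \<in> W"
    using W yz by (simp add: vec_subspace_iff)
  moreover have "y + (-1) \<cdot>\<^sub>v z = y - z"
    using dims by auto
  moreover have "y - z \<noteq> 0\<^sub>v t"
  proof
    assume eq: "y - z = 0\<^sub>v t"
    have "y = z"
    proof (rule eq_vecI)
      show "dim_vec y = dim_vec z"
        using dims by simp
      fix i assume "i < dim_vec z"
      then show "y $ i = z $ i"
        using arg_cong[OF eq, of "\<lambda>v. v $ i"] dims by simp
    qed
    with yz show False by simp
  qed
  moreover have "(y - z) \<bullet> u = 0"
    using yz dims u by (simp add: minus_scalar_prod_distrib)
  ultimately show ?thesis by metis
qed

section \<open>Cycles as vertex lists\<close>

text \<open>
  The vertices of a cycle are listed without repeating the first one at the end. Working with a bare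
  relation lets the combinatorial arguments proceed without arcs and walks.
\<close>

definition vertex_cycle :: "('v \<times> 'v) set \<Rightarrow> 'v list \<Rightarrow> bool" where
  "vertex_cycle E vs \<longleftrightarrow> distinct vs \<and> 3 \<le> length vs \<and>
     successively (\<lambda>u v. (u, v) \<in> E) vs \<and> (last vs, hd vs) \<in> E"

lemma (in pair_wf_digraph) awalk_imp_successively:
  "awalk u p v \<Longrightarrow> successively (\<lambda>u v. (u, v) \<in> parcs G) (pawalk_verts u p) \<and>
     hd (pawalk_verts u p) = u \<and> last (pawalk_verts u p) = v \<and>
     length (pawalk_verts u p) = Suc (length p)"
proof (induction p arbitrary: u)
  case Nil
  then show ?case by (simp add: awalk_Nil_iff)
next
  case (Cons e p)
  then have "e \<in> parcs G" "u = fst e" "awalk (snd e) p v"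
    by (auto simp: awalk_Cons_iff)
  with Cons.IH[of "snd e"] show ?case
    by (cases "pawalk_verts (snd e) p") auto
qed

lemma (in pair_wf_digraph) successively_imp_awalk:
  "successively (\<lambda>u v. (u, v) \<in> parcs G) (u # vs) \<Longrightarrow> u \<in> pverts G \<Longrightarrow>
     awalk u (vwalk_arcs (u # vs)) (last (u # vs)) \<and> pawalk_verts u (vwalk_arcs (u # vs)) = u # vs"
proof (induction vs arbitrary: u)
  case Nil
  then show ?case by (simp add: awalk_Nil_iff)
next
  case (Cons v vs)
  then show ?case
    using Cons.IH[of v] in_arcsD2 by (auto simp: awalk_Cons_iff simp del: vwalk_arcs_Cons)
qed

text \<open>
  A closed walk lists its base point twice. Dropping the first occurrence gives the vertex list;
  conversely, putting the last vertex in front of the list gives back a closed walk.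
\<close>

lemma (in pair_wf_digraph) undirected_cycle_iff_vertex_cycle:
  "(\<exists>p. undirected_cycle G p) \<longleftrightarrow> (\<exists>vs. vertex_cycle (parcs G) vs)"
proof
  assume "\<exists>p. undirected_cycle G p"
  then obtain p u where p: "awalk u p u" "distinct (tl (pawalk_verts u p))" "3 \<le> length p"
    by (auto simp: undirected_cycle_def cycle_def)
  then obtain vs where vs: "pawalk_verts u p = u # vs"
    using awalk_imp_successively[OF p(1)] by (cases "pawalk_verts u p") auto
  then have "vertex_cycle (parcs G) vs"
    using awalk_imp_successively[OF p(1)] p by (cases vs) (auto simp: vertex_cycle_def)
  then show "\<exists>vs. vertex_cycle (parcs G) vs" ..
next
  assume "\<exists>vs. vertex_cycle (parcs G) vs"
  then obtain vs where vs: "vertex_cycle (parcs G) vs" ..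
  define u where "u = last vs"
  have ne: "vs \<noteq> []" and arc: "(u, hd vs) \<in> parcs G"
    using vs by (auto simp: vertex_cycle_def u_def)
  then have "successively (\<lambda>u v. (u, v) \<in> parcs G) (u # vs)" "u \<in> pverts G"
    using vs in_arcsD1 by (auto simp: vertex_cycle_def successively_Cons)
  from successively_imp_awalk[OF this] ne
  have "awalk u (vwalk_arcs (u # vs)) u" "pawalk_verts u (vwalk_arcs (u # vs)) = u # vs"
    by (auto simp: u_def)
  moreover from this awalk_imp_successively[OF this(1)]
  have "length (vwalk_arcs (u # vs)) = length vs" by simp
  ultimately have "undirected_cycle G (vwalk_arcs (u # vs))"
    using vs ne unfolding undirected_cycle_def cycle_def vertex_cycle_def
    by (auto intro!: exI[of _ u])
  then show "\<exists>p. undirected_cycle G p" ..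
qed

lemma (in pair_wf_digraph) vertex_cycle_subset_verts:
  assumes "vertex_cycle (parcs G) vs"
  shows "set vs \<subseteq> pverts G"
proof
  fix v assume "v \<in> set vs"
  then obtain i where i: "i < length vs" "v = vs ! i"
    by (auto simp: in_set_conv_nth)
  show "v \<in> pverts G"
  proof (cases "Suc i < length vs")
    case True
    then have "(v, vs ! Suc i) \<in> parcs G"
      using assms i by (auto simp: vertex_cycle_def successively_conv_nth)
    then show ?thesis by (rule in_arcsD1)
  next
    case False
    then have "v = last vs"
      using i by (metis Suc_lessI diff_Suc_1 last_conv_nth length_0_conv not_less_zero)
    then show ?thesis
      using assms by (auto simp: vertex_cycle_def dest: in_arcsD1)
  qed
qed

section \<open>Acyclic graphs\<close>

text \<open>
  The first vertex \<open>u\<close> of a longest path inside \<open>S\<close> has all its neighbours in \<open>S\<close> on the path. If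
  there were two, one of them would not be the second vertex of the path, and the piece of the path
  from \<open>u\<close> to it would close to a cycle of length at least \<open>3\<close>.
\<close>

lemma acyclic_imp_vertex_of_degree_le_1:
  assumes sym: "sym E" and irrefl: "irrefl E"
    and S: "finite S" "S \<noteq> {}" and acyc: "\<nexists>vs. vertex_cycle E vs"
  shows "\<exists>v\<in>S. \<forall>a\<in>S. \<forall>b\<in>S. (v, a) \<in> E \<longrightarrow> (v, b) \<in> E \<longrightarrow> a = b"
proof (rule ccontr)
  assume "\<not> ?thesis"
  then have two: "\<exists>a\<in>S. \<exists>b\<in>S. (v, a) \<in> E \<and> (v, b) \<in> E \<and> a \<noteq> b" if "v \<in> S" for v
    using that by blast
  define P where "P xs \<longleftrightarrow> xs \<noteq> [] \<and> distinct xs \<and> set xs \<subseteq> S \<and>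
    successively (\<lambda>u v. (u, v) \<in> E) xs" for xs
  obtain s where "s \<in> S" using S by blast
  then have "P [s]" by (simp add: P_def)
  moreover have "length xs < Suc (card S)" if "P xs" for xs
    using that S(1) distinct_card[of xs] card_mono[of S "set xs"] by (auto simp: P_def)
  ultimately obtain xs where xs: "P xs" and longest: "\<And>ys. P ys \<Longrightarrow> length ys \<le> length xs"
    using ex_has_greatest_nat[of P "[s]" length "Suc (card S)"] by blast
  obtain u ys where u: "xs = u # ys"
    using xs by (cases xs) (auto simp: P_def)
  then have "u \<in> S" using xs by (auto simp: P_def)
  have in_ys: "w \<in> set ys" if w: "w \<in> S" "(u, w) \<in> E" for w
  proof (rule ccontr)
    assume "w \<notin> set ys"
    moreover have "w \<noteq> u" using w irrefl by (auto simp: irrefl_def)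
    ultimately have "P (w # xs)"
      using xs u w symD[OF sym] by (auto simp: P_def)
    from longest[OF this] show False by simp
  qed
  from two[OF \<open>u \<in> S\<close>] obtain w where w: "w \<in> S" "(u, w) \<in> E" "w \<noteq> hd ys"
    by metis
  then obtain p q where pq: "ys = p @ w # q"
    using in_ys split_list by metis
  with w(3) have "p \<noteq> []" by auto
  moreover have "successively (\<lambda>u v. (u, v) \<in> E) ((u # p @ [w]) @ q)"
    using xs u pq by (simp add: P_def)
  then have "successively (\<lambda>u v. (u, v) \<in> E) (u # p @ [w])"
    by (rule successively_append_iff[THEN iffD1, THEN conjunct1])
  ultimately have "vertex_cycle E (u # p @ [w])"
    using xs u pq symD[OF sym w(2)]
    by (cases p) (auto simp: P_def vertex_cycle_def)
  with acyc show False by blast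
qed

text \<open>
  The induction takes a vertex with at most one neighbour in \<open>S\<close> out of \<open>S\<close> and assigns its vector last.
\<close>

lemma acyclic_imp_orthogonal_choice:
  fixes W :: "'v \<Rightarrow> 'f::{field, finite} vec set"
  assumes sym: "sym E" and irrefl: "irrefl E" and acyc: "\<nexists>vs. vertex_cycle E vs"
    and "finite S"
    and W: "\<And>v. v \<in> S \<Longrightarrow> VectorSpace.subspace class_ring (W v) (module_vec TYPE('f) t)"
    and card: "\<And>v. v \<in> S \<Longrightarrow> CARD('f) < card (W v)"
  shows "\<exists>x. (\<forall>v\<in>S. x v \<in> W v \<and> x v \<noteq> 0\<^sub>v t) \<and>
    (\<forall>u\<in>S. \<forall>v\<in>S. (u, v) \<in> E \<longrightarrow> x u \<bullet> x v = 0)"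
  using \<open>finite S\<close> W card
proof (induction S rule: finite_psubset_induct)
  case (psubset S)
  show ?case
  proof (cases "S = {}")
    case False
    obtain v where v: "v \<in> S"
      and unique: "\<And>a b. a \<in> S \<Longrightarrow> b \<in> S \<Longrightarrow> (v, a) \<in> E \<Longrightarrow> (v, b) \<in> E \<Longrightarrow> a = b"
      using acyclic_imp_vertex_of_degree_le_1[OF sym irrefl psubset.hyps False acyc] by blast
    obtain x where x: "\<And>w. w \<in> S - {v} \<Longrightarrow> x w \<in> W w \<and> x w \<noteq> 0\<^sub>v t"
      and orth: "\<And>a b. a \<in> S - {v} \<Longrightarrow> b \<in> S - {v} \<Longrightarrow> (a, b) \<in> E \<Longrightarrow> x a \<bullet> x b = 0"
      using psubset.IH[of "S - {v}"] psubset.prems v by blast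
    have carrier: "x w \<in> carrier_vec t" if "w \<in> S - {v}" for w
      using x[OF that] psubset.prems(1)[of w] that by (auto simp: vec_subspace_iff)
    have noloop: "(w, w) \<notin> E" for w
      using irrefl by (simp add: irrefl_def)
    have "\<exists>u \<in> carrier_vec t. \<forall>w\<in>S. (v, w) \<in> E \<longrightarrow> x w = u"
    proof (cases "\<exists>w\<in>S. (v, w) \<in> E")
      case True
      then obtain w where w: "w \<in> S" "(v, w) \<in> E" by blast
      then have "x w \<in> carrier_vec t"
        using noloop by (intro carrier) auto
      then show ?thesis
        using unique w by blast
    qed (use zero_carrier_vec in blast)
    then obtain u where u: "u \<in> carrier_vec t" "\<And>w. w \<in> S \<Longrightarrow> (v, w) \<in> E \<Longrightarrow> x w = u"
      by blast
    obtain y where y: "y \<in> W v" "y \<noteq> 0\<^sub>v t" "y \<bullet> u = 0"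
      using exists_nonzero_orthogonal[OF psubset.prems(1,2)[OF v] u(1)] by blast
    have ycar: "y \<in> carrier_vec t"
      using y psubset.prems(1)[OF v] by (auto simp: vec_subspace_iff)
    have "(x(v := y)) a \<bullet> (x(v := y)) b = 0" if ab: "a \<in> S" "b \<in> S" "(a, b) \<in> E" for a b
    proof -
      consider "a = v" "b \<noteq> v" | "a \<noteq> v" "b = v" | "a \<noteq> v" "b \<noteq> v"
        using ab noloop by metis
      then show ?thesis
      proof cases
        case 1
        then show ?thesis using ab u y by auto
      next
        case 2
        then have "x a = u" using ab u symD[OF sym] by blast
        then show ?thesis
          using 2 y comm_scalar_prod[OF ycar u(1)] by simp
      next
        case 3
        then show ?thesis using ab orth by simp
      qed
    qed
    then show ?thesis
      using x y by (intro exI[of _ "x(v := y)"]) auto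
  qed auto
qed

section \<open>Graphs with a cycle\<close>

text \<open>
  The map \<open>T \<mapsto> T\<^sup>2 - T\<close> takes the same value at \<open>0\<close> and \<open>1\<close>; being a map of a finite set to itself, it
  then misses some \<open>c\<close>. The polynomial \<open>T\<^sup>2 - T - c\<close> has no root, and the form below is its
  homogenization. This construction is uniform in the characteristic.
\<close>

lemma exists_anisotropic_form:
  "\<exists>c :: 'f::{field, finite}. \<forall>a b. a\<^sup>2 - a * b - c * b\<^sup>2 = 0 \<longrightarrow> a = 0 \<and> b = 0"
proof -
  define g where "g T = T\<^sup>2 - T" for T :: 'f
  have "g 0 = g 1" by (simp add: g_def)
  then have "\<not> inj g" by (metis injD zero_neq_one)
  then have "\<not> surj g"
    using finite_UNIV_surj_inj[of g] by auto
  then obtain c where c: "\<And>T. g T \<noteq> c"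
    by (metis surj_def)
  have "a = 0 \<and> b = 0" if ab: "a\<^sup>2 - a * b - c * b\<^sup>2 = 0" for a b
  proof (cases "b = 0")
    case False
    then have "g (a / b) = c"
      using ab by (simp add: g_def field_simps power2_eq_square)
    with c show ?thesis by blast
  qed (use ab in simp)
  then show ?thesis by blast
qed

text \<open>
  The plane in the space of dimension 4 that is the graph of the \<open>2 \<times> 2\<close> matrix with rows \<open>(p, q)\<close> and \<open>(r, s)\<close>,
  parametrized by the first two coordinates.
\<close>

definition plane_vec :: "'f::field \<Rightarrow> 'f \<Rightarrow> 'f \<Rightarrow> 'f \<Rightarrow> 'f \<times> 'f \<Rightarrow> 'f vec" where
  "plane_vec p q r s = (\<lambda>(a, b). vec_of_list [a, b, p * a + q * b, r * a + s * b])"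

lemma plane_vec_carrier: "plane_vec p q r s z \<in> carrier_vec 4"
  by (cases z) (auto simp: plane_vec_def intro!: carrier_vecI)

lemma plane_vec_0: "plane_vec p q r s (0, 0) = 0\<^sub>v 4"
  by (simp add: plane_vec_def numeral_eq_Suc zero_vec_Suc)

lemma plane_vec_add:
  "plane_vec p q r s (a, b) + plane_vec p q r s (a', b') = plane_vec p q r s (a + a', b + b')"
  by (rule eq_vecI) (auto simp: plane_vec_def algebra_simps less_Suc_eq)

lemma plane_vec_smult:
  "k \<cdot>\<^sub>v plane_vec p q r s (a, b) = plane_vec p q r s (k * a, k * b)"
  by (rule eq_vecI) (auto simp: plane_vec_def algebra_simps less_Suc_eq)

lemma plane_vec_scalar_prod:
  "plane_vec p q r s (a, b) \<bullet> plane_vec p' q' r' s' (a', b') =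
    a * a' + b * b' + (p * a + q * b) * (p' * a' + q' * b') + (r * a + s * b) * (r' * a' + s' * b')"
  by (simp add: plane_vec_def algebra_simps)

lemma inj_plane_vec: "inj (plane_vec p q r s)"
  by (auto simp: inj_def plane_vec_def)

lemma subspace_range_plane_vec:
  fixes p q r s :: "'f::{field, finite}"
  shows "VectorSpace.subspace class_ring (range (plane_vec p q r s)) (module_vec TYPE('f) 4)"
  unfolding vec_subspace_iff
  by (auto simp: plane_vec_carrier plane_vec_add plane_vec_smult
      simp flip: plane_vec_0[of p q r s])

lemma dim_range_plane_vec:
  fixes p q r s :: "'f::{field, finite}"
  shows "vectorspace.dim class_ring
    ((module_vec TYPE('f) 4)\<lparr>carrier := range (plane_vec p q r s)\<rparr>) = 2"
  unfolding subspace_dim_iff_card[OF subspace_range_plane_vec]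
  by (simp add: card_image inj_plane_vec card_prod power2_eq_square)

lemma orthogonal_imp_rotated:
  fixes a b a' b' :: "'f::field"
  assumes "(a, b) \<noteq> (0, 0)" "(a', b') \<noteq> (0, 0)" "a * a' + b * b' = 0"
  shows "\<exists>k. k \<noteq> 0 \<and> a' = - (k * b) \<and> b' = k * a"
proof (cases "a = 0")
  case True
  then show ?thesis
    using assms by (intro exI[of _ "- (a' / b)"]) auto
next
  case False
  then have "a' = - (b' / a * b)"
    using assms(3) by (simp add: field_simps eq_neg_iff_add_eq_0)
  then show ?thesis
    using assms False by (intro exI[of _ "b' / a"]) auto
qed

text \<open>
  Each step is a quarter turn up to a nonzero scalar. Two quarter turns are a half turn, that is, the
  scalar \<open>-1\<close>, so only the parity of the number of steps matters.
\<close>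

lemma orthogonal_chain:
  fixes a b :: "nat \<Rightarrow> 'f::field"
  assumes "\<And>i. i \<le> m \<Longrightarrow> (a i, b i) \<noteq> (0, 0)"
    and "\<And>i. i < m \<Longrightarrow> a i * a (Suc i) + b i * b (Suc i) = 0"
  shows "\<exists>k. k \<noteq> 0 \<and> (if even m then a m = k * a 0 \<and> b m = k * b 0
    else a m = - (k * b 0) \<and> b m = k * a 0)"
  using assms
proof (induction m)
  case 0
  show ?case by (intro exI[of _ 1]) simp
next
  case (Suc m)
  then obtain k where k: "k \<noteq> 0" "if even m then a m = k * a 0 \<and> b m = k * b 0
    else a m = - (k * b 0) \<and> b m = k * a 0"
    by (metis le_Suc_eq less_Suc_eq)
  obtain l where l: "l \<noteq> 0" "a (Suc m) = - (l * b m)" "b (Suc m) = l * a m"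
    using orthogonal_imp_rotated[of "a m" "b m" "a (Suc m)" "b (Suc m)"] Suc.prems by auto
  show ?case
  proof (cases "even m")
    case True
    then show ?thesis using k l by (intro exI[of _ "l * k"]) auto
  next
    case False
    then show ?thesis using k l by (intro exI[of _ "- (l * k)"]) auto
  qed
qed

text \<open>
  The spaces are the plane of the first two coordinates at the inner vertices of the path
  \<open>v\<^sub>0, \<dots>, v\<^sub>m\<close>, the graph of the identity at \<open>v\<^sub>m\<close>, and the graph of a matrix \<open>A\<close> at \<open>v\<^sub>0\<close>. On the
  closing edge the scalar product is then \<open>x\<^sup>T (1 + A\<^sup>T) y\<close>, where \<open>y\<close> is, up to a scalar, \<open>x\<close> itself or
  \<open>x\<close> turned by a right angle. In each of the two cases \<open>A\<close> is solved for so as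
  to make this expression a multiple of the anisotropic form at \<open>x\<close>. Since \<open>m \<ge> 2\<close>, each edge of the path has
  an inner vertex, so that \<open>A\<close> does not interfere with the edges of the path.
\<close>

lemma vertex_cycle_imp_no_orthogonal_choice:
  assumes cyc: "vertex_cycle E vs"
  shows "\<exists>W :: 'v \<Rightarrow> 'f::{field, finite} vec set.
    (\<forall>v. \<exists>p q r s. W v = range (plane_vec p q r s)) \<and>
    (\<nexists>x. (\<forall>v\<in>set vs. x v \<in> W v \<and> x v \<noteq> 0\<^sub>v 4) \<and> (\<forall>(u, v)\<in>E. x u \<bullet> x v = 0))"
proof -
  obtain c :: 'f where c: "\<And>a b. a\<^sup>2 - a * b - c * b\<^sup>2 = 0 \<Longrightarrow> a = 0 \<and> b = 0"
    using exists_anisotropic_form by blast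
  define m where "m = length vs - 1"
  have len: "length vs = Suc m" and m: "2 \<le> m"
    using cyc by (auto simp: vertex_cycle_def m_def)
  have ne: "vs \<noteq> []" using len by auto
  have dist: "vs ! i = vs ! j \<longleftrightarrow> i = j" if "i \<le> m" "j \<le> m" for i j
    using cyc that len by (auto simp: vertex_cycle_def nth_eq_iff_index_eq)
  have arc: "(vs ! i, vs ! Suc i) \<in> E" if "i < m" for i
    using cyc that len by (auto simp: vertex_cycle_def successively_conv_nth)
  have closing: "(vs ! m, vs ! 0) \<in> E"
    using cyc len ne by (auto simp: vertex_cycle_def last_conv_nth hd_conv_nth)
  define P :: "'v \<Rightarrow> 'f \<times> 'f \<Rightarrow> 'f vec" where
    "P v = (if v = vs ! 0 then if even m then plane_vec 0 0 (-1) (- (c + 1)) else plane_vec 0 c 1 (-1)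
       else if v = vs ! m then plane_vec 1 0 0 1 else plane_vec 0 0 0 0)" for v
  have plane: "\<exists>p q r s. P v = plane_vec p q r s" for v
    unfolding P_def by metis
  have "\<nexists>x. (\<forall>v\<in>set vs. x v \<in> range (P v) \<and> x v \<noteq> 0\<^sub>v 4) \<and> (\<forall>(u, v)\<in>E. x u \<bullet> x v = 0)"
  proof
    assume "\<exists>x. (\<forall>v\<in>set vs. x v \<in> range (P v) \<and> x v \<noteq> 0\<^sub>v 4) \<and> (\<forall>(u, v)\<in>E. x u \<bullet> x v = 0)"
    then obtain x where choice: "\<forall>v\<in>set vs. x v \<in> range (P v) \<and> x v \<noteq> 0\<^sub>v 4"
      and "\<forall>(u, v)\<in>E. x u \<bullet> x v = 0"
      by (elim exE conjE)
    then have orth: "x u \<bullet> x v = 0" if "(u, v) \<in> E" for u v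
      using that by (auto split: prod.splits)
    have x: "x v \<in> range (P v)" and nz: "x v \<noteq> 0\<^sub>v 4" if "v \<in> set vs" for v
      using choice that by simp_all
    have "\<forall>i. \<exists>z. i \<le> m \<longrightarrow> x (vs ! i) = P (vs ! i) z"
      using x len by (metis less_Suc_eq_le nth_mem rangeE)
    then obtain z where z: "\<And>i. i \<le> m \<Longrightarrow> x (vs ! i) = P (vs ! i) (z i)"
      by metis
    define a where "a i = fst (z i)" for i
    define b where "b i = snd (z i)" for i
    have ab: "x (vs ! i) = P (vs ! i) (a i, b i)" if "i \<le> m" for i
      using z[OF that] by (simp add: a_def b_def)
    have P0: "P v (0, 0) = 0\<^sub>v 4" for v
      by (simp add: P_def plane_vec_0)
    have nonzero: "(a i, b i) \<noteq> (0, 0)" if "i \<le> m" for i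
    proof
      assume "(a i, b i) = (0, 0)"
      then have "x (vs ! i) = 0\<^sub>v 4"
        using ab[OF that] P0 by simp
      then show False
        using nz[of "vs ! i"] that len by simp
    qed
    have chain: "a i * a (Suc i) + b i * b (Suc i) = 0" if i: "i < m" for i
    proof -
      \<comment> \<open>One of the two planes has zero third and fourth coordinates, which cancels the other's.\<close>
      have "P (vs ! i) (a i, b i) \<bullet> P (vs ! Suc i) (a (Suc i), b (Suc i)) = 0"
        using orth[OF arc[OF i]] ab i by simp
      moreover have "P (vs ! i) = plane_vec 0 0 0 0 \<or> P (vs ! Suc i) = plane_vec 0 0 0 0"
        using i m dist[of i 0] dist[of "Suc i" 0] dist[of i m] dist[of "Suc i" m]
        by (cases "i = 0") (simp_all add: P_def)
      moreover obtain p q r s p' q' r' s' where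
        "P (vs ! i) = plane_vec p q r s" "P (vs ! Suc i) = plane_vec p' q' r' s'"
        using plane by metis
      ultimately show ?thesis
        using plane_vec_scalar_prod[of 0 0 0 0] plane_vec_scalar_prod[of _ _ _ _ _ _ 0 0 0 0]
        by (metis (no_types, opaque_lifting) add.right_neutral mult_zero_left mult_zero_right)
    qed
    obtain k where k: "k \<noteq> 0" and ends: "if even m then a m = k * a 0 \<and> b m = k * b 0
        else a m = - (k * b 0) \<and> b m = k * a 0"
      using orthogonal_chain[of m a b] nonzero chain by blast
    have close: "P (vs ! m) (a m, b m) \<bullet> P (vs ! 0) (a 0, b 0) = 0"
      using orth[OF closing] ab[of m] ab[of 0] by simp
    have Pm: "P (vs ! m) = plane_vec 1 0 0 1"
      using m dist[of m 0] by (simp add: P_def)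
    have "k * ((a 0)\<^sup>2 - a 0 * b 0 - c * (b 0)\<^sup>2) = 0"
    proof (cases "even m")
      case True
      then have "P (vs ! 0) = plane_vec 0 0 (-1) (- (c + 1))"
        by (simp add: P_def)
      with close ends True show ?thesis
        by (simp add: Pm plane_vec_scalar_prod algebra_simps power2_eq_square)
    next
      case False
      then have "P (vs ! 0) = plane_vec 0 c 1 (-1)"
        by (simp add: P_def)
      with close ends False show ?thesis
        by (simp add: Pm plane_vec_scalar_prod algebra_simps power2_eq_square)
    qed
    then have "a 0 = 0 \<and> b 0 = 0"
      using k by (intro c) simp
    then show False
      using nonzero[of 0] by simp
  qed
  moreover have "\<exists>p q r s. range (P v) = range (plane_vec p q r s)" for v
    using plane by metis
  ultimately show ?thesis
    by (intro exI[of _ "\<lambda>v. range (P v)"] conjI allI)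
qed

section \<open>The characterisation\<close>

theorem proposition1p9:
  fixes G :: "'v pair_pre_digraph"
  assumes "pair_graph G"
  shows "subspace_choosable TYPE('f::{field, finite}) 2 G \<longleftrightarrow> \<not> (\<exists>p. undirected_cycle G p)"
proof -
  interpret pair_graph G by fact
  have E: "sym (parcs G)" "irrefl (parcs G)"
    using arcs_symmetric no_loops' by (auto intro!: symI simp: irrefl_def)
  have "\<not> subspace_choosable TYPE('f) 2 G" if cyc: "vertex_cycle (parcs G) vs" for vs
  proof
    assume choosable: "subspace_choosable TYPE('f) 2 G"
    obtain W :: "'v \<Rightarrow> 'f vec set" where W: "\<And>v. \<exists>p q r s. W v = range (plane_vec p q r s)"
      and none: "\<nexists>x. (\<forall>v\<in>set vs. x v \<in> W v \<and> x v \<noteq> 0\<^sub>v 4) \<and> (\<forall>(u, v)\<in>parcs G. x u \<bullet> x v = 0)"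
      using vertex_cycle_imp_no_orthogonal_choice[OF cyc] by blast
    have "VectorSpace.subspace class_ring (W v) (module_vec TYPE('f) 4) \<and>
      vectorspace.dim class_ring ((module_vec TYPE('f) 4)\<lparr>carrier := W v\<rparr>) = 2" for v
      using W[of v] subspace_range_plane_vec dim_range_plane_vec by metis
    then obtain x where "\<forall>v\<in>pverts G. x v \<in> W v \<and> x v \<noteq> 0\<^sub>v 4"
      "\<forall>(v, v')\<in>parcs G. x v \<bullet> x v' = 0"
      using choosable unfolding subspace_choosable_def by blast
    then show False
      using vertex_cycle_subset_verts[OF cyc] none by blast
  qed
  moreover have "subspace_choosable TYPE('f) 2 G" if acyc: "\<nexists>vs. vertex_cycle (parcs G) vs"
    unfolding subspace_choosable_def
  proof (intro allI impI)
    fix t and W :: "'v \<Rightarrow> 'f vec set"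
    assume W: "\<forall>v\<in>pverts G. VectorSpace.subspace class_ring (W v) (module_vec TYPE('f) t) \<and>
      vectorspace.dim class_ring ((module_vec TYPE('f) t)\<lparr>carrier := W v\<rparr>) = 2"
    have "CARD('f) < card (W v)" if "v \<in> pverts G" for v
      using W that card_field_gt_1[where 'f='f] card_subspace[of "W v" t]
      by (simp add: power2_eq_square)
    then obtain x where "\<forall>v\<in>pverts G. x v \<in> W v \<and> x v \<noteq> 0\<^sub>v t"
      "\<forall>u\<in>pverts G. \<forall>v\<in>pverts G. (u, v) \<in> parcs G \<longrightarrow> x u \<bullet> x v = 0"
      using acyclic_imp_orthogonal_choice[OF E acyc pair_finite_verts, of W t] W by blast
    then show "\<exists>x. (\<forall>v\<in>pverts G. x v \<in> W v \<and> x v \<noteq> 0\<^sub>v t) \<and>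
        (\<forall>(v, v')\<in>parcs G. x v \<bullet> x v' = 0)"
      using wellformed' by blast
  qed
  ultimately show ?thesis
    unfolding undirected_cycle_iff_vertex_cycle by blast
qed

end
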